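(* There exists no pair of Pythagorean triangles such that the leg of largest length in the first triangle has the same length as the hypotenuse of the second triangle and, in addition, the leg of smallest length in the first triangle has the same length as a leg of the second triangle.
   Context: A Pythagorean triangle is a right triangle all of whose side lengths are positive integers. *)

theory Defs
  imports "HOL-Analysis.Analysis"
begin

text \<open>
  A triangle in the Euclidean plane is given by its vertices. In a right triangle the last
  vertex \<open>C\<close> is the one at which the right angle lies, so the legs are \<open>AC\<close>, \<open>BC\<close> and the
  hypotenuse is \<open>AB\<close>.
\<close>

definition right_triangle :: "real^2 \<Rightarrow> real^2 \<Rightarrow> real^2 \<Rightarrow> bool" where
  "right_triangle A B C \<longleftrightarrow> \<not> collinear {A, B, C} \<and> orthogonal (A - C) (B - C)"

definition pythagorean_triangle :: "real^2 \<Rightarrow> real^2 \<Rightarrow> real^2 \<Rightarrow> bool" where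
  "pythagorean_triangle A B C \<longleftrightarrow>
     right_triangle A B C \<and> {dist A C, dist B C, dist A B} \<subseteq> \<nat> - {0}"

definition leg_lengths :: "real^2 \<Rightarrow> real^2 \<Rightarrow> real^2 \<Rightarrow> real set" where
  "leg_lengths A B C = {dist A C, dist B C}"

definition hypotenuse_length :: "real^2 \<Rightarrow> real^2 \<Rightarrow> real^2 \<Rightarrow> real" where
  "hypotenuse_length A B C = dist A B"

end

theory Submission
  imports Defs "HOL-Computational_Algebra.Nth_Powers"
begin

text \<open>
  Two such triangles give positive integers with \<open>a\<^sup>2 + d\<^sup>2 = b\<^sup>2\<close> and \<open>a\<^sup>2 + b\<^sup>2 = c\<^sup>2\<close>.
  Fermat's infinite descent on \<open>b\<close> excludes this. Assume \<open>a, b\<close> coprime and put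
  \<open>u = (c + d) / 2\<close>, \<open>v = (c - d) / 2\<close>, so that \<open>u\<^sup>2 + v\<^sup>2 = b\<^sup>2\<close> and \<open>2 u v = a\<^sup>2\<close> with \<open>u, v\<close>
  coprime. If \<open>v\<close> is the even one, then \<open>u = m\<^sup>2\<close> and \<open>v = 2 n\<^sup>2\<close>, hence
  \<open>(b - m\<^sup>2) / 2\<close> and \<open>(b + m\<^sup>2) / 2\<close> are coprime with product \<open>n\<^sup>4\<close>, so they are fourth powers
  \<open>r\<^sup>4\<close> and \<open>t\<^sup>4\<close>. Finally \<open>(t\<^sup>2 - r\<^sup>2) (t\<^sup>2 + r\<^sup>2) = m\<^sup>2\<close> makes both factors squares, and
  \<open>t < b\<close>.
\<close>

lemma coprime_mult_eq_square_nat: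
  fixes x y z :: nat
  assumes "coprime x y" "x * y = z\<^sup>2"
  obtains m n where "x = m\<^sup>2" "y = n\<^sup>2" "m * n = z"
proof -
  have "is_nth_power 2 (x * y)"
    using assms(2) by (auto simp: is_nth_power_def)
  then have "is_nth_power 2 x" "is_nth_power 2 y"
    using is_nth_power_mult_coprime_nat_iff[OF assms(1)] by simp_all
  then obtain m n where mn: "x = m\<^sup>2" "y = n\<^sup>2"
    by (auto simp: is_nth_power_def)
  have "(m * n)\<^sup>2 = z\<^sup>2"
    using assms(2) mn by (simp add: power_mult_distrib)
  then show thesis
    using that mn by simp
qed

text \<open>The square case applied twice: the square roots of \<open>x\<close> and \<open>y\<close>
  are again coprime, and their product is the square \<open>z\<^sup>2\<close>.\<close>

lemma coprime_mult_eq_power4_nat: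
  fixes x y z :: nat
  assumes "coprime x y" "x * y = z ^ 4"
  obtains m n where "x = m ^ 4" "y = n ^ 4"
proof -
  have "x * y = (z\<^sup>2)\<^sup>2"
    using assms(2) by simp
  with assms(1) obtain k l where kl: "x = k\<^sup>2" "y = l\<^sup>2" "k * l = z\<^sup>2"
    by (rule coprime_mult_eq_square_nat)
  have "coprime k l"
    using assms(1) kl by simp
  then obtain m n where "k = m\<^sup>2" "l = n\<^sup>2"
    using kl(3) by (rule coprime_mult_eq_square_nat)
  then show thesis
    using that kl by simp
qed

lemma coprime_nat_primeI:
  fixes x y :: nat
  assumes "\<And>p. prime p \<Longrightarrow> p dvd x \<Longrightarrow> p dvd y \<Longrightarrow> False"
  shows "coprime x y"
  using assms by (meson coprime_iff_gcd_eq_1 gcd_dvd1 gcd_dvd2 dvd_trans prime_factor_nat)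

lemma congruum_descent:
  fixes u v a b :: nat
  assumes "u > 0" "v > 0" "coprime u v" "even v"
    and sq: "u\<^sup>2 + v\<^sup>2 = b\<^sup>2" and area: "2 * u * v = a\<^sup>2"
  obtains r s t w where "r > 0" "s > 0" "r\<^sup>2 + s\<^sup>2 = t\<^sup>2" "r\<^sup>2 + t\<^sup>2 = w\<^sup>2" "t < b"
proof -
  obtain h where h: "v = 2 * h"
    using \<open>even v\<close> by blast
  have "even (a\<^sup>2)"
    using area by (metis dvd_triv_left mult.assoc)
  then obtain k where k: "a = 2 * k"
    by auto
  have uh: "u * h = k\<^sup>2" "coprime u h" "odd u"
    using area h k \<open>coprime u v\<close> by (auto simp: power2_eq_square)
  obtain m n where m: "u = m\<^sup>2" and n: "h = n\<^sup>2"
    using coprime_mult_eq_square_nat[OF uh(2,1)] by blast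
  have pos: "m > 0" "n > 0" "odd m" "coprime m n"
    using m n h uh assms(1,2) by auto
  have eq: "(m\<^sup>2)\<^sup>2 + 4 * n ^ 4 = b\<^sup>2"
    using sq m n h by (simp add: power_mult_distrib flip: power_mult)
  have "odd b"
  proof -
    have "odd (b\<^sup>2)"
      unfolding eq[symmetric] using pos by simp
    then show ?thesis
      by simp
  qed
  moreover have "m\<^sup>2 < b"
  proof -
    have "(m\<^sup>2)\<^sup>2 < b\<^sup>2"
      using eq pos by (simp flip: eq)
    then show ?thesis
      using power2_less_imp_less by blast
  qed
  moreover have "odd (m\<^sup>2)"
    using pos by simp
  ultimately have "even (b - m\<^sup>2)" "b - m\<^sup>2 > 0"
    by auto
  then obtain x where "b - m\<^sup>2 = 2 * x"
    by blast
  then have x: "b = m\<^sup>2 + 2 * x" "x > 0"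
    using \<open>b - m\<^sup>2 > 0\<close> \<open>m\<^sup>2 < b\<close> by auto
  \<comment> \<open>Here \<open>x\<close> is \<open>(b - m\<^sup>2) / 2\<close> and
    \<open>x + m\<^sup>2\<close> is \<open>(b + m\<^sup>2) / 2\<close>.\<close>
  have xn: "x * (x + m\<^sup>2) = n ^ 4"
    using eq x(1) by (simp add: power2_eq_square algebra_simps)
  have "coprime x m"
  proof (rule coprime_nat_primeI)
    fix p :: nat
    assume p: "prime p" "p dvd x" "p dvd m"
    then have "p dvd n ^ 4"
      using xn by (metis dvd_mult2)
    then have "p dvd n"
      using p prime_dvd_power by blast
    then show False
      using p pos by (meson coprime_common_divisor not_prime_unit)
  qed
  then have "coprime x (m\<^sup>2)"
    by simp
  then have "coprime x (x + m\<^sup>2)"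
    by (simp only: coprime_iff_gcd_eq_1 gcd_add2)
  then obtain r t where r: "x = r ^ 4" and t: "x + m\<^sup>2 = t ^ 4"
    using xn by (rule coprime_mult_eq_power4_nat)
  have "r > 0"
    using x r by (cases "r = 0") auto
  have rt: "r ^ 4 + m\<^sup>2 = t ^ 4"
    using r t by simp
  have "(r\<^sup>2)\<^sup>2 < (t\<^sup>2)\<^sup>2"
    using rt pos by (simp flip: power_mult rt)
  then have "r\<^sup>2 < t\<^sup>2"
    using power2_less_imp_less by blast
  \<comment> \<open>Writing \<open>e\<close> for the difference of \<open>t\<^sup>2\<close> and
    \<open>r\<^sup>2\<close> avoids truncated subtraction; their sum becomes
    \<open>2 * r\<^sup>2 + e\<close>.\<close>
  then obtain e where e: "t\<^sup>2 = r\<^sup>2 + e" "e > 0"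
    using less_imp_add_positive by metis
  have "r ^ 4 + m\<^sup>2 = (r\<^sup>2 + e)\<^sup>2"
    using rt e(1) by (metis mult_2 numeral_Bit0 power_even_eq)
  then have em: "e * (2 * r\<^sup>2 + e) = m\<^sup>2"
    by (simp add: power2_eq_square power4_eq_xxxx algebra_simps)
  \<comment> \<open>A common prime divides the odd number \<open>m\<close>, so it is not 2; it then
    divides \<open>r\<close>, hence \<open>x\<close>, which is coprime to \<open>m\<close>.\<close>
  have "coprime e (2 * r\<^sup>2 + e)"
  proof (rule coprime_nat_primeI)
    fix p :: nat
    assume p: "prime p" "p dvd e" "p dvd 2 * r\<^sup>2 + e"
    have "p dvd m\<^sup>2"
      using em p by (metis dvd_mult2)
    then have "p dvd m"
      using p prime_dvd_power by blast
    then have "p \<noteq> 2"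
      using pos by blast
    have "p dvd 2 * r\<^sup>2"
      using p by (simp add: dvd_add_left_iff)
    then have "p dvd r"
      using p \<open>p \<noteq> 2\<close> by (metis prime_dvd_mult_iff prime_dvd_power primes_dvd_imp_eq two_is_prime_nat)
    then have "p dvd x"
      using r by (simp add: power4_eq_xxxx)
    then show False
      using p \<open>p dvd m\<close> \<open>coprime x m\<close> by (meson coprime_common_divisor not_prime_unit)
  qed
  then obtain s w where s: "e = s\<^sup>2" and w: "2 * r\<^sup>2 + e = w\<^sup>2"
    using em by (rule coprime_mult_eq_square_nat)
  \<comment> \<open>The chain is
    \<open>t \<le> t ^ 4 = x + m\<^sup>2 < 2 * x + m\<^sup>2 = b\<close>.\<close>
  have "t < b"
  proof -
    have "t \<le> t ^ 4"
      by (cases "t = 0") (auto simp: self_le_power)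
    then show ?thesis
      using x t by linarith
  qed
  moreover have "s > 0"
    using s e by (cases "s = 0") auto
  moreover have "r\<^sup>2 + s\<^sup>2 = t\<^sup>2" "r\<^sup>2 + t\<^sup>2 = w\<^sup>2"
    using e s w by simp_all
  ultimately show thesis
    using that \<open>r > 0\<close> by blast
qed

lemma no_congruent_square_pair:
  fixes a b c d :: nat
  assumes "a > 0" "d > 0" "a\<^sup>2 + d\<^sup>2 = b\<^sup>2" "a\<^sup>2 + b\<^sup>2 = c\<^sup>2"
  shows False
  using assms
proof (induction b arbitrary: a c d rule: less_induct)
  case (less b)
  note d = less.prems(3) and c = less.prems(4)
  have "b > 0"
    using less.prems by (cases "b = 0") auto
  show False
  proof (cases "coprime a b")
    \<comment> \<open>The reduction to coprime \<open>a, b\<close> is itself a descent: the common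
      factor \<open>g\<close> also divides \<open>c\<close> and \<open>d\<close>, and cancelling it
      makes \<open>b\<close> smaller.\<close>
    case False
    define g where "g = gcd a b"
    have "g \<noteq> 1" "g > 0"
      using False less.prems by (auto simp: g_def coprime_iff_gcd_eq_1)
    then have "g > 1"
      by simp
    obtain a' b' where a': "a = g * a'" and b': "b = g * b'"
      unfolding g_def by (meson dvdE gcd_dvd1 gcd_dvd2)
    have "g\<^sup>2 dvd c\<^sup>2"
      unfolding c[symmetric] a' b' by (simp add: power_mult_distrib)
    then obtain c' where c': "c = g * c'"
      by auto
    have "g\<^sup>2 dvd d\<^sup>2"
      using d unfolding a' b' by (metis dvd_add_right_iff dvd_triv_left power_mult_distrib)
    then obtain d' where d': "d = g * d'"
      by auto
    have "g\<^sup>2 * (a'\<^sup>2 + d'\<^sup>2) = g\<^sup>2 * b'\<^sup>2" "g\<^sup>2 * (a'\<^sup>2 + b'\<^sup>2) = g\<^sup>2 * c'\<^sup>2"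
      using c d unfolding a' b' c' d' by (simp_all add: power_mult_distrib distrib_left)
    then have "a'\<^sup>2 + d'\<^sup>2 = b'\<^sup>2" "a'\<^sup>2 + b'\<^sup>2 = c'\<^sup>2"
      using \<open>g > 0\<close> by simp_all
    moreover have "a' > 0" "d' > 0" "b' < b"
      using less.prems \<open>g > 1\<close> \<open>b > 0\<close> a' b' d' by auto
    ultimately show False
      using less.IH by blast
  next
    case True
    have cd: "c\<^sup>2 = d\<^sup>2 + 2 * a\<^sup>2"
      using c d by simp
    then have "d\<^sup>2 < c\<^sup>2"
      using less.prems(1) by simp
    then have "d < c"
      using power2_less_imp_less by blast
    moreover have "even c \<longleftrightarrow> even d"
    proof -
      have "even (c\<^sup>2) \<longleftrightarrow> even (d\<^sup>2)"
        unfolding cd by simp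
      then show ?thesis
        by simp
    qed
    ultimately have "even (c - d)" "c - d > 0"
      by auto
    then obtain v where "c - d = 2 * v"
      by blast
    then have v: "c = d + 2 * v" "v > 0"
      using \<open>c - d > 0\<close> by auto
    \<comment> \<open>With \<open>c = d + 2 * v\<close> this is \<open>(c + d) / 2\<close>, written
      without division.\<close>
    define u where "u = d + v"
    have area: "2 * u * v = a\<^sup>2"
      using cd unfolding v(1) u_def by (simp add: power2_eq_square algebra_simps)
    have sq: "u\<^sup>2 + v\<^sup>2 = b\<^sup>2"
      unfolding d[symmetric] area[symmetric] u_def by (simp add: power2_eq_square algebra_simps)
    have "u > 0"
      using v u_def by simp
    \<comment> \<open>A common prime would divide both \<open>2 * u * v = a\<^sup>2\<close> and
      \<open>u\<^sup>2 + v\<^sup>2 = b\<^sup>2\<close>.\<close>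
    have uv: "coprime u v"
    proof (rule coprime_nat_primeI)
      fix p :: nat
      assume p: "prime p" "p dvd u" "p dvd v"
      have "p dvd a\<^sup>2"
        using area p by (metis dvd_mult)
      moreover have "p dvd b\<^sup>2"
        unfolding sq[symmetric] using p by (simp add: power2_eq_square)
      ultimately have "p dvd a" "p dvd b"
        using p prime_dvd_power by blast+
      then show False
        using p True by (meson coprime_common_divisor not_prime_unit)
    qed
    have "even (a\<^sup>2)"
      using area by (metis dvd_triv_left mult.assoc)
    then obtain k where "a = 2 * k"
      by auto
    then have "u * v = 2 * k\<^sup>2"
      using area by (simp add: power2_eq_square)
    then have "even (u * v)"
      by simp
    then consider "even v" | "even u"
      by auto
    then show False
    proof cases
      case 1
      then show False
        using congruum_descent[OF \<open>u > 0\<close> \<open>v > 0\<close> uv _ sq area] less.IH by metis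
    next
      case 2
      have "coprime v u" "v\<^sup>2 + u\<^sup>2 = b\<^sup>2" "2 * v * u = a\<^sup>2"
        using uv sq area by (simp_all add: coprime_commute add.commute mult.commute mult.left_commute)
      then show False
        using congruum_descent[OF \<open>v > 0\<close> \<open>u > 0\<close> _ 2] less.IH by metis
    qed
  qed
qed

text \<open>The passage from geometry to arithmetic: the inner product at \<open>C\<close> vanishes,
  so expanding the norm of \<open>(A - C) - (B - C)\<close> gives Pythagoras.\<close>

lemma pythagorean_triangle_lengths:
  assumes "pythagorean_triangle A B C"
  obtains x y z :: nat where "x > 0" "y > 0"
    "leg_lengths A B C = {real x, real y}" "hypotenuse_length A B C = real z" "x\<^sup>2 + y\<^sup>2 = z\<^sup>2"
proof -
  have orth: "(A - C) \<bullet> (B - C) = 0"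
    and nats: "{dist A C, dist B C, dist A B} \<subseteq> \<nat> - {0}"
    using assms by (auto simp: pythagorean_triangle_def right_triangle_def orthogonal_def)
  obtain x y z where xyz: "dist A C = real x" "dist B C = real y" "dist A B = real z"
    using nats by (auto elim!: Nats_cases)
  have "(norm ((A - C) - (B - C)))\<^sup>2 = (norm (A - C))\<^sup>2 + (norm (B - C))\<^sup>2"
    using orth by (simp add: power2_norm_eq_inner inner_diff inner_commute)
  then have "(dist A C)\<^sup>2 + (dist B C)\<^sup>2 = (dist A B)\<^sup>2"
    by (simp add: dist_norm)
  then have "real (x\<^sup>2 + y\<^sup>2) = real (z\<^sup>2)"
    unfolding xyz by simp
  then have "x\<^sup>2 + y\<^sup>2 = z\<^sup>2"
    by (simp only: of_nat_eq_iff)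
  moreover have "x > 0" "y > 0"
    using nats unfolding xyz by auto
  ultimately show thesis
    using that xyz by (simp add: leg_lengths_def hypotenuse_length_def)
qed

theorem theorem1:
  "\<not> (\<exists>A B C A' B' C'.
        pythagorean_triangle A B C \<and> pythagorean_triangle A' B' C' \<and>
        Max (leg_lengths A B C) = hypotenuse_length A' B' C' \<and>
        Min (leg_lengths A B C) \<in> leg_lengths A' B' C')"
proof (clarify)
  fix A B C A' B' C' :: "real^2"
  assume 1: "pythagorean_triangle A B C" and 2: "pythagorean_triangle A' B' C'"
    and max: "Max (leg_lengths A B C) = hypotenuse_length A' B' C'"
    and min: "Min (leg_lengths A B C) \<in> leg_lengths A' B' C'"
  obtain x y c where xy: "x > 0" "y > 0" "leg_lengths A B C = {real x, real y}" "x\<^sup>2 + y\<^sup>2 = c\<^sup>2"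
    using pythagorean_triangle_lengths[OF 1] by metis
  obtain p q b where pq: "p > 0" "q > 0" "leg_lengths A' B' C' = {real p, real q}"
    "hypotenuse_length A' B' C' = real b" "p\<^sup>2 + q\<^sup>2 = b\<^sup>2"
    using pythagorean_triangle_lengths[OF 2] by metis
  define a where "a = min x y"
  have b: "b = max x y"
    using max xy(3) pq(4) by (simp add: max_def split: if_splits)
  have "a = p \<or> a = q"
    using min xy(3) pq(3) by (auto simp: a_def min_def split: if_splits)
  \<comment> \<open>The shared leg is \<open>a\<close>, and \<open>d\<close> is the other leg of the
    second triangle.\<close>
  then obtain d where "d > 0" "a\<^sup>2 + d\<^sup>2 = b\<^sup>2"
    using pq by (metis add.commute)
  moreover have "a\<^sup>2 + b\<^sup>2 = c\<^sup>2"
    using xy(4) by (auto simp: a_def b min_def max_def)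
  moreover have "a > 0"
    using xy by (simp add: a_def)
  ultimately show False
    using no_congruent_square_pair by blast
qed

end
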